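(* For any two partitions $\mu^1,\mu^2$, every coefficient $C_k(\mu^1,(\mu^2)^t)$ ($k\in\mathbb{Z}$) is zero or a positive integer. Indeed, $$f_{\mu^1(\mu^2)^t}(q)=-\sum_{i,j\ge1}\left(q^{\mu^1_i-\mu^2_j+j-i}-q^{j-i}\right).$$
   Context: A partition $\mu$ is a nonincreasing sequence $\mu_1\ge\mu_2\ge\cdots$ of nonnegative integers with finitely many nonzero terms; $\mu^t$ is the transposed partition (transposed Young diagram). For partitions $\lambda,\mu$ define $f_{\lambda\mu}(q)=q\left(\sum_{i\ge1}q^{\lambda_i-i}\sum_{j\ge1}q^{\mu_j-j}-\sum_{i\ge1}q^{-i}\sum_{j\ge1}q^{-j}\right)$ (series summed for $|q|>1$). This is a Laurent polynomial in $q$ with integer coefficients, and $C_k(\lambda,\mu)$ denotes its coefficients: $f_{\lambda\mu}(q)=\sum_{k\in\mathbb{Z}}C_k(\lambda,\mu)q^k$. The infinite double sum in the claim is understood formally, coefficient by coefficient: for each integer $m$ only finitely many pairs $(i,j)$ have a summand $q^{\mu^1_i-\mu^2_j+j-i}-q^{j-i}$ with a nonzero coefficient of $q^m$, and these coefficients are added. *)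

theory Defs
  imports
    Complex_Main
    "HOL-Library.Poly_Mapping"
    "HOL-Computational_Algebra.Polynomial"
begin

section \<open>Partitions\<close>

text \<open>
  Parts are indexed from \<open>0\<close>: the value \<open>p i\<close> is the \<open>(i + 1)\<close>-st part. Accordingly an
  exponent \<open>p\<^sub>i - i\<close> with \<open>i \<ge> 1\<close> becomes \<open>p i - Suc i\<close> with \<open>i \<ge> 0\<close>.
\<close>

definition is_partition :: "(nat \<Rightarrow> nat) \<Rightarrow> bool" where
  "is_partition p \<longleftrightarrow> antimono p \<and> finite {i. p i \<noteq> 0}"

definition young_diagram :: "(nat \<Rightarrow> nat) \<Rightarrow> (nat \<times> nat) set" where
  "young_diagram p = {(i, j). j < p i}"

text \<open>Row \<open>j\<close> of the transposed diagram is column \<open>j\<close> of the diagram.\<close>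

definition transpose_partition :: "(nat \<Rightarrow> nat) \<Rightarrow> nat \<Rightarrow> nat" where
  "transpose_partition p j = card {i. (i, j) \<in> young_diagram p}"

lemma is_partition_bound:
  assumes "is_partition p"
  obtains N where "\<And>i. i \<ge> N \<Longrightarrow> p i = 0"
proof -
  from assms have "finite {i. p i \<noteq> 0}" by (simp add: is_partition_def)
  then obtain N where "\<forall>i\<in>{i. p i \<noteq> 0}. i < N"
    using finite_nat_set_iff_bounded by blast
  then have "\<And>i. i \<ge> N \<Longrightarrow> p i = 0" by fastforce
  then show thesis by (rule that)
qed

lemma column_eq:
  assumes "is_partition p"
  shows "{i. (i, j) \<in> young_diagram p} = {..<transpose_partition p j}"
proof -
  obtain N where N: "\<And>i. i \<ge> N \<Longrightarrow> p i = 0"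
    using is_partition_bound[OF assms] by blast
  define n where "n = (LEAST i. p i \<le> j)"
  have n1: "p n \<le> j" unfolding n_def by (rule LeastI[of _ N]) (simp add: N)
  have n2: "\<not> p i \<le> j" if "i < n" for i using that not_less_Least unfolding n_def by blast
  have "{i. (i, j) \<in> young_diagram p} = {..<n}"
  proof (rule set_eqI)
    fix i
    show "i \<in> {i. (i, j) \<in> young_diagram p} \<longleftrightarrow> i \<in> {..<n}"
    proof (cases "i < n")
      case True
      then show ?thesis using n2[of i] by (simp add: young_diagram_def)
    next
      case False
      then have "p i \<le> p n"
        using assms by (simp add: is_partition_def antimonoD)
      then show ?thesis using False n1 by (simp add: young_diagram_def)
    qed
  qed
  then show ?thesis by (simp add: transpose_partition_def)
qed

lemma young_diagram_transpose:
  assumes "is_partition p"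
  shows "young_diagram (transpose_partition p) = (young_diagram p)\<inverse>"
proof (intro set_eqI)
  fix x :: "nat \<times> nat"
  obtain j i where x: "x = (j, i)" by (cases x)
  have "(j, i) \<in> young_diagram (transpose_partition p) \<longleftrightarrow> i \<in> {..<transpose_partition p j}"
    by (simp add: young_diagram_def)
  also have "\<dots> \<longleftrightarrow> (i, j) \<in> young_diagram p"
    by (simp flip: column_eq[OF assms])
  finally show "x \<in> young_diagram (transpose_partition p) \<longleftrightarrow> x \<in> (young_diagram p)\<inverse>"
    by (simp add: x)
qed

lemma is_partition_transpose:
  assumes "is_partition p"
  shows "is_partition (transpose_partition p)"
  unfolding is_partition_def
proof
  show "antimono (transpose_partition p)"
  proof (rule antimonoI)
    fix j k :: nat assume "j \<le> k"
    then have "{i. (i, k) \<in> young_diagram p} \<subseteq> {i. (i, j) \<in> young_diagram p}"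
      by (auto simp: young_diagram_def)
    then show "transpose_partition p k \<le> transpose_partition p j"
      using column_eq[OF assms] by (metis lessThan_subset_iff)
  qed
  have "transpose_partition p j = 0" if "j \<ge> p 0" for j
  proof -
    have "p i \<le> j" for i
      using assms that antimonoD[of p 0 i] by (force simp: is_partition_def)
    then have "{i. (i, j) \<in> young_diagram p} = {}" by (simp add: young_diagram_def not_less)
    then show ?thesis by (simp add: transpose_partition_def)
  qed
  then have "{j. transpose_partition p j \<noteq> 0} \<subseteq> {..<p 0}"
    by (metis (mono_tags, lifting) lessThan_iff mem_Collect_eq not_le subsetI)
  then show "finite {j. transpose_partition p j \<noteq> 0}"
    using finite_subset by blast
qed


section \<open>Laurent polynomials with integer coefficients\<close>

text \<open>
  A Laurent polynomial in one variable is a finitely supported family of coefficients indexed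
  by \<open>\<int>\<close>; \<open>Poly_Mapping.lookup P k\<close> is the coefficient of the \<open>k\<close>-th power.
\<close>

type_synonym laurent_poly = "int \<Rightarrow>\<^sub>0 int"

definition qpow :: "int \<Rightarrow> laurent_poly" where
  "qpow k = Poly_Mapping.single k 1"

definition laurent_eval :: "laurent_poly \<Rightarrow> complex \<Rightarrow> complex" where
  "laurent_eval P q = (\<Sum>k\<in>Poly_Mapping.keys P. of_int (Poly_Mapping.lookup P k) * q powi k)"

lemma laurent_eval_0 [simp]: "laurent_eval 0 q = 0"
  by (simp add: laurent_eval_def)

lemma laurent_eval_qpow [simp]: "laurent_eval (qpow k) q = q powi k"
  by (simp add: laurent_eval_def qpow_def)

lemma laurent_eval_add: "laurent_eval (P + Q) q = laurent_eval P q + laurent_eval Q q"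
  unfolding laurent_eval_def by (rule setsum_keys_plus_distrib) (auto simp: algebra_simps)

lemma laurent_eval_diff: "laurent_eval (P - Q) q = laurent_eval P q - laurent_eval Q q"
  using laurent_eval_add[of "P - Q" Q q] by simp

lemma laurent_eval_sum: "laurent_eval (sum F A) q = (\<Sum>a\<in>A. laurent_eval (F a) q)"
  by (induction A rule: infinite_finite_induct) (simp_all add: laurent_eval_add)

lemma laurent_eval_mult:
  assumes "q \<noteq> 0"
  shows "laurent_eval (P * Q) q = laurent_eval P q * laurent_eval Q q"
proof -
  have 1: "laurent_eval (qpow k * Q) q = q powi k * laurent_eval Q q" for k
  proof (rule frag_induction[where c = Q and S = UNIV])
    fix x :: int
    have "qpow k * qpow x = qpow (k + x)" by (simp add: qpow_def mult_single)
    then show "laurent_eval (qpow k * frag_of x) q = q powi k * laurent_eval (frag_of x) q"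
      using assms by (simp flip: qpow_def add: power_int_add)
  qed (simp_all add: right_diff_distrib laurent_eval_diff)
  show ?thesis
  proof (rule frag_induction[where c = P and S = UNIV])
    fix x :: int
    show "laurent_eval (frag_of x * Q) q = laurent_eval (frag_of x) q * laurent_eval Q q"
      using 1[of x] by (simp flip: qpow_def)
  qed (simp_all add: left_diff_distrib laurent_eval_diff)
qed

lemma laurent_eval_eq_0_imp:
  assumes "\<And>q. norm q > 1 \<Longrightarrow> laurent_eval P q = 0"
  shows "P = 0"
proof -
  have fin: "finite (Poly_Mapping.keys P)" by simp
  obtain M :: int where M: "\<And>k. k \<in> Poly_Mapping.keys P \<Longrightarrow> k + M \<ge> 0"
  proof
    fix k assume k: "k \<in> Poly_Mapping.keys P"
    have "\<bar>k\<bar> \<le> (\<Sum>k\<in>Poly_Mapping.keys P. \<bar>k\<bar>)"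
      by (rule member_le_sum) (use k in auto)
    then show "k + (\<Sum>k\<in>Poly_Mapping.keys P. \<bar>k\<bar>) \<ge> 0" by linarith
  qed
  define R :: "complex poly" where
    "R = (\<Sum>k\<in>Poly_Mapping.keys P. monom (of_int (Poly_Mapping.lookup P k)) (nat (k + M)))"
  have "poly R q = 0" if q: "norm q > 1" for q
  proof -
    have q0: "q \<noteq> 0" using q by auto
    have "poly R q = (\<Sum>k\<in>Poly_Mapping.keys P. q powi M * (of_int (Poly_Mapping.lookup P k) * q powi k))"
      unfolding R_def poly_sum
    proof (rule sum.cong)
      fix k assume "k \<in> Poly_Mapping.keys P"
      then have "q ^ nat (k + M) = q powi (k + M)" using M by (simp add: power_int_def)
      then show "poly (monom (of_int (Poly_Mapping.lookup P k)) (nat (k + M))) q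
          = q powi M * (of_int (Poly_Mapping.lookup P k) * q powi k)"
        using q0 by (simp add: poly_monom power_int_add)
    qed simp
    also have "\<dots> = q powi M * laurent_eval P q"
      by (simp add: laurent_eval_def sum_distrib_left)
    finally show ?thesis using assms[OF q] by simp
  qed
  moreover have "infinite {q :: complex. norm q > 1}"
  proof -
    have "range (\<lambda>n. of_nat (n + 2) :: complex) \<subseteq> {q. norm q > 1}"
    proof clarsimp
      fix n :: nat
      have "norm (of_nat (n + 2) :: complex) = real (n + 2)" by (rule norm_of_nat)
      then show "1 < cmod (2 + complex_of_nat n)" by (simp add: add.commute)
    qed
    moreover have "infinite (range (\<lambda>n. of_nat (n + 2) :: complex))"
      by (rule range_inj_infinite) (auto simp: inj_on_def)
    ultimately show ?thesis using finite_subset by blast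
  qed
  ultimately have "infinite {q. poly R q = 0}"
    by (metis (mono_tags, lifting) finite_subset mem_Collect_eq subsetI)
  then have R: "R = 0" using poly_roots_finite by blast
  have "Poly_Mapping.lookup P l = 0" for l
  proof (rule ccontr)
    assume "Poly_Mapping.lookup P l \<noteq> 0"
    then have l: "l \<in> Poly_Mapping.keys P" by (simp add: in_keys_iff)
    have "coeff R (nat (l + M))
        = (\<Sum>k\<in>Poly_Mapping.keys P. if k = l then of_int (Poly_Mapping.lookup P k) else 0)"
      unfolding R_def coeff_sum
      by (rule sum.cong) (use M l in \<open>auto simp: eq_nat_nat_iff\<close>)
    also have "\<dots> = of_int (Poly_Mapping.lookup P l)" using l by simp
    finally show False using R \<open>Poly_Mapping.lookup P l \<noteq> 0\<close> by simp
  qed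
  then show ?thesis by (intro poly_mapping_eqI) simp
qed


section \<open>The function \<open>f\<close> and its coefficients\<close>

definition f_fun :: "(nat \<Rightarrow> nat) \<Rightarrow> (nat \<Rightarrow> nat) \<Rightarrow> complex \<Rightarrow> complex" where
  "f_fun l m q = q *
     (suminf (\<lambda>i. q powi (int (l i) - int (Suc i))) * suminf (\<lambda>j. q powi (int (m j) - int (Suc j)))
      - suminf (\<lambda>i. q powi (- int (Suc i))) * suminf (\<lambda>j. q powi (- int (Suc j))))"

text \<open>The existence and uniqueness needed here are proved in \<open>f_fun_Laurent\<close> below.\<close>

definition f_laurent :: "(nat \<Rightarrow> nat) \<Rightarrow> (nat \<Rightarrow> nat) \<Rightarrow> laurent_poly" where
  "f_laurent l m = (THE P. \<forall>q. norm q > 1 \<longrightarrow> f_fun l m q = laurent_eval P q)"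

definition C_coeff :: "int \<Rightarrow> (nat \<Rightarrow> nat) \<Rightarrow> (nat \<Rightarrow> nat) \<Rightarrow> int" where
  "C_coeff k l m = Poly_Mapping.lookup (f_laurent l m) k"

lemma inverse_powers_sums:
  fixes q :: complex
  assumes "norm q > 1"
  shows "(\<lambda>i. q powi (- int (Suc i))) sums (1 / (q - 1))"
proof -
  have q: "q \<noteq> 0" "q \<noteq> 1" using assms by auto
  have "norm (inverse q) < 1"
    using assms by (simp add: norm_inverse inverse_less_1_iff)
  then have "(\<lambda>i. inverse q * inverse q ^ i) sums (inverse q * (1 / (1 - inverse q)))"
    by (intro sums_mult geometric_sums)
  moreover have "inverse q * (1 / (1 - inverse q)) = 1 / (q - 1)"
    using q by (simp add: field_simps)
  moreover have "inverse q * inverse q ^ i = q powi (- int (Suc i))" for i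
    unfolding power_int_minus power_int_of_nat by (simp add: power_inverse)
  ultimately show ?thesis by simp
qed

lemma partition_series_sums:
  assumes "is_partition p"
  obtains P where "\<And>q. norm q > 1 \<Longrightarrow>
    (\<lambda>i. q powi (int (p i) - int (Suc i))) sums ((q - 1) * laurent_eval P q + 1 / (q - 1))"
proof -
  obtain N where N: "\<And>i. i \<ge> N \<Longrightarrow> p i = 0"
    using is_partition_bound[OF assms] by blast
  define P where "P = (\<Sum>i<N. \<Sum>k<p i. qpow (int k - int (Suc i)))"
  show thesis
  proof (rule that[of P])
    fix q :: complex assume q: "norm q > 1"
    then have q0: "q \<noteq> 0" by auto
    let ?d = "\<lambda>i. q powi (int (p i) - int (Suc i)) - q powi (- int (Suc i))"
    have "?d sums (\<Sum>i<N. ?d i)"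
      by (rule sums_finite) (auto simp: N)
    moreover have "(\<Sum>i<N. ?d i) = (q - 1) * laurent_eval P q"
    proof -
      have "?d i = (q - 1) * (\<Sum>k<p i. q powi (int k - int (Suc i)))" for i
      proof -
        have *: "q powi (int k - int (Suc i)) = q powi (- int (Suc i)) * q ^ k" for k
        proof -
          have "int k - int (Suc i) = - int (Suc i) + int k" by simp
          then show ?thesis
            using power_int_add[of q "- int (Suc i)" "int k"] q0 by (simp only: power_int_of_nat simp_thms)
        qed
        have "?d i = q powi (- int (Suc i)) * (q ^ p i - 1)"
          unfolding * by (simp only: right_diff_distrib mult_1_right)
        also have "\<dots> = (q - 1) * (q powi (- int (Suc i)) * (\<Sum>k<p i. q ^ k))"
          unfolding power_diff_1_eq by (simp only: ac_simps)
        finally show ?thesis unfolding * sum_distrib_left[symmetric] .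
      qed
      then show ?thesis
        by (simp add: P_def laurent_eval_sum sum_distrib_left)
    qed
    ultimately have "?d sums ((q - 1) * laurent_eval P q)" by simp
    from sums_add[OF this inverse_powers_sums[OF q]]
    show "(\<lambda>i. q powi (int (p i) - int (Suc i))) sums ((q - 1) * laurent_eval P q + 1 / (q - 1))"
      by simp
  qed
qed

lemma f_fun_Laurent:
  assumes "is_partition l" "is_partition m"
  shows "\<exists>!P. \<forall>q. norm q > 1 \<longrightarrow> f_fun l m q = laurent_eval P q"
proof -
  obtain A where A: "\<And>q. norm q > 1 \<Longrightarrow>
    (\<lambda>i. q powi (int (l i) - int (Suc i))) sums ((q - 1) * laurent_eval A q + 1 / (q - 1))"
    using partition_series_sums[OF assms(1)] by blast
  obtain B where B: "\<And>q. norm q > 1 \<Longrightarrow>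
    (\<lambda>i. q powi (int (m i) - int (Suc i))) sums ((q - 1) * laurent_eval B q + 1 / (q - 1))"
    using partition_series_sums[OF assms(2)] by blast
  define D where "D = qpow 1 - qpow 0"
  define P where "P = qpow 1 * (D * D * A * B + A + B)"
  have ex: "f_fun l m q = laurent_eval P q" if q: "norm q > 1" for q
  proof -
    have q0: "q \<noteq> 0" and q1: "q - 1 \<noteq> 0" using q by auto
    have "f_fun l m q = q * (((q - 1) * laurent_eval A q + 1 / (q - 1))
        * ((q - 1) * laurent_eval B q + 1 / (q - 1)) - 1 / (q - 1) * (1 / (q - 1)))"
      unfolding f_fun_def sums_unique[OF A[OF q], symmetric] sums_unique[OF B[OF q], symmetric]
        sums_unique[OF inverse_powers_sums[OF q], symmetric] ..
    also have "((q - 1) * a + 1 / (q - 1)) * ((q - 1) * b + 1 / (q - 1)) - 1 / (q - 1) * (1 / (q - 1))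
        = (q - 1) * (q - 1) * a * b + a + b" for a b
    proof -
      define r where "r = 1 / (q - 1)"
      have r: "(q - 1) * r = 1" using q1 by (simp add: r_def)
      have "((q - 1) * a + r) * ((q - 1) * b + r) - r * r
        = (q - 1) * (q - 1) * a * b + a * ((q - 1) * r) + b * ((q - 1) * r)"
        by (simp add: algebra_simps)
      then show ?thesis by (simp only: r r_def[symmetric] mult_1_right)
    qed
    finally show ?thesis
      using q0 by (simp add: P_def D_def laurent_eval_mult laurent_eval_add laurent_eval_diff)
  qed
  moreover have "Q = P" if "\<forall>q. norm q > 1 \<longrightarrow> f_fun l m q = laurent_eval Q q" for Q
  proof -
    have "Q - P = 0"
      by (rule laurent_eval_eq_0_imp) (use that ex in \<open>simp add: laurent_eval_diff\<close>)
    then show ?thesis by simp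
  qed
  ultimately show ?thesis by blast
qed

lemma f_laurent_eval:
  assumes "is_partition l" "is_partition m" "norm q > 1"
  shows "f_fun l m q = laurent_eval (f_laurent l m) q"
  using theI'[OF f_fun_Laurent[OF assms(1,2)]] assms(3) unfolding f_laurent_def by blast


section \<open>Formal double sums\<close>

text \<open>
  The coefficient of the \<open>k\<close>-th power in a formal double sum. \<open>Sum_any\<close> adds the finitely many
  nonzero contributions; it returns \<open>0\<close> if there are infinitely many, which
  \<open>finite_contributions\<close> below rules out for the family of interest.
  Exponents of the form \<open>\<mu> i - \<nu> j + j - i\<close> are insensitive to the index shift, as only \<open>j - i\<close> enters.
\<close>

definition formal_sum_coeff :: "(nat \<Rightarrow> nat \<Rightarrow> laurent_poly) \<Rightarrow> int \<Rightarrow> int" where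
  "formal_sum_coeff F k = Sum_any (\<lambda>(i, j). Poly_Mapping.lookup (F i j) k)"

lemma finite_contributions:
  assumes "is_partition \<mu>" "is_partition \<nu>"
  shows "finite {(i, j). Poly_Mapping.lookup
      (qpow (int (\<mu> i) - int (\<nu> j) + int j - int i) - qpow (int j - int i)) k \<noteq> 0}"
proof -
  obtain M where M: "\<And>i. i \<ge> M \<Longrightarrow> \<mu> i = 0"
    using is_partition_bound[OF assms(1)] by blast
  obtain N where N: "\<And>i. i \<ge> N \<Longrightarrow> \<nu> i = 0"
    using is_partition_bound[OF assms(2)] by blast
  define B where "B = M + N + nat \<bar>k\<bar> + \<mu> 0 + \<nu> 0"
  have le: "\<mu> i \<le> \<mu> 0" "\<nu> i \<le> \<nu> 0" for i
    using assms by (auto simp: is_partition_def antimonoD)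
  have "i \<le> B \<and> j \<le> B" if "Poly_Mapping.lookup
      (qpow (int (\<mu> i) - int (\<nu> j) + int j - int i) - qpow (int j - int i)) k \<noteq> 0" for i j
  proof -
    have 1: "int (\<mu> i) - int (\<nu> j) + int j - int i = k \<or> int j - int i = k"
    proof (rule ccontr)
      assume "\<not> ?thesis"
      then have "int (\<mu> i) - int (\<nu> j) + int j - int i \<noteq> k" "int j - int i \<noteq> k"
        by blast+
      then have "Poly_Mapping.lookup (qpow (int (\<mu> i) - int (\<nu> j) + int j - int i)) k = 0"
        "Poly_Mapping.lookup (qpow (int j - int i)) k = 0"
        unfolding qpow_def by (simp_all only: lookup_single_not_eq not_False_eq_True)
      then show False using that by (simp add: lookup_minus)
    qed
    have 2: "i < M \<or> j < N"
    proof (rule ccontr)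
      assume "\<not> (i < M \<or> j < N)"
      then have "\<mu> i = 0" "\<nu> j = 0" using M[of i] N[of j] by auto
      then show False using that by simp
    qed
    have k: "k \<le> int (nat \<bar>k\<bar>)" "- k \<le> int (nat \<bar>k\<bar>)" by simp_all
    have B: "int B = int M + int N + int (nat \<bar>k\<bar>) + int (\<mu> 0) + int (\<nu> 0)"
      unfolding B_def by (simp only: of_nat_add)
    have ij: "int (\<mu> i) \<le> int (\<mu> 0)" "int (\<nu> j) \<le> int (\<nu> 0)"
      using le by simp_all
    have pos: "int (\<mu> i) \<ge> 0" "int (\<nu> j) \<ge> 0" by simp_all
    from 1 have d: "int j - int i \<le> int (nat \<bar>k\<bar>) + int (\<nu> 0)"
      "int i - int j \<le> int (nat \<bar>k\<bar>) + int (\<mu> 0)"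
      using k ij pos by (auto simp del: nat_0_le int_nat_eq)
    from 2 have "int i \<le> int B \<and> int j \<le> int B"
    proof
      assume "i < M"
      then show ?thesis unfolding B using d by simp
    next
      assume "j < N"
      then show ?thesis unfolding B using d by simp
    qed
    then show ?thesis by simp
  qed
  then have "{(i, j). Poly_Mapping.lookup
      (qpow (int (\<mu> i) - int (\<nu> j) + int j - int i) - qpow (int j - int i)) k \<noteq> 0} \<subseteq> {..B} \<times> {..B}"
    by auto
  then show ?thesis by (rule finite_subset) simp
qed

end

theory Submission
  imports Defs
begin

text \<open>
  Write \<open>K\<^sub>p\<close> for the content polynomial \<open>\<Sum> q\<^sup>j\<^sup>-\<^sup>i\<close> of a partition \<open>p\<close>, summed over the cells
  \<open>(i, j)\<close> of its Young diagram. Along each row the contents are consecutive, so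
  \<open>(q - 1) K\<^sub>p\<close> telescopes to \<open>\<Sum>\<^sub>i (q powi (p\<^sub>i - i) - q powi (-i))\<close>. Hence both series in \<open>f\<close> are
  geometric series corrected by a multiple of a content polynomial, and
  \<open>f\<^sub>\<lambda>\<^sub>\<mu> = (q - 2 + q powi (-1)) K\<^sub>\<lambda> K\<^sub>\<mu> + K\<^sub>\<lambda> + K\<^sub>\<mu>\<close> (\<open>f_laurent_content\<close>).

  Transposition negates all contents, so \<open>K\<close> of the transpose of \<open>\<nu>\<close> telescopes against the powers
  \<open>q powi (j - \<nu>\<^sub>j)\<close>. Multiplying the two telescoped sums, both taken over indices below \<open>M\<close>, gives
  the polynomial of \<open>\<lambda>\<close> and the transpose of \<open>\<nu>\<close> up to the two error terms \<open>q\<^sup>M K\<close> and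
  \<open>q powi (-M) K\<close> (\<open>truncated_double_sum\<close>). For a fixed power \<open>q powi k\<close> these are out of range once
  \<open>M\<close> is large, which is the formal identity.

  For the sign, the coefficient of \<open>q powi k\<close> in the truncated double sum is a difference of two
  counts of index pairs below \<open>M\<close>: the pairs with \<open>j - i = k\<close>, of which there are \<open>M - \<bar>k\<bar>\<close>, and
  the pairs with \<open>\<lambda>\<^sub>i - i = \<nu>\<^sub>j - j + k\<close>. In the second set each index determines the other, as
  \<open>\<lambda>\<^sub>i - i\<close> and \<open>\<nu>\<^sub>j - j\<close> are strictly decreasing; and for \<open>k \<ge> 0\<close> the last \<open>k\<close> values of \<open>i\<close>
  cannot occur, because there \<open>\<lambda>\<^sub>i - i = -i\<close> lies below every \<open>\<nu>\<^sub>j - j + k\<close>. So at most \<open>M - k\<close>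
  pairs remain. Negative \<open>k\<close> is the same with the partitions exchanged.
\<close>

section \<open>Content polynomials\<close>

definition content_poly :: "(nat \<Rightarrow> nat) \<Rightarrow> laurent_poly" where
  "content_poly p = (\<Sum>(i, j)\<in>young_diagram p. qpow (int j - int i))"

lemma qpow_mult: "qpow a * qpow b = qpow (a + b)"
  by (simp add: qpow_def mult_single)

lemma qpow_0: "qpow 0 = 1"
  by (simp add: qpow_def)

lemma laurent_eval_1: "laurent_eval 1 q = 1"
  by (simp flip: qpow_0)

lemma lookup_qpow: "Poly_Mapping.lookup (qpow a) k = (if a = k then 1 else 0)"
  by (simp add: qpow_def lookup_single when_def)

lemma young_diagram_Sigma:
  assumes "\<And>i. i \<ge> M \<Longrightarrow> p i = 0"
  shows "young_diagram p = Sigma {..<M} (\<lambda>i. {..<p i})"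
  by (auto simp: young_diagram_def) (metis assms not_le not_less_zero)

lemma content_poly_rows:
  assumes "\<And>i. i \<ge> M \<Longrightarrow> p i = 0"
  shows "content_poly p = (\<Sum>i<M. \<Sum>j<p i. qpow (int j - int i))"
  by (simp add: content_poly_def young_diagram_Sigma[OF assms] sum.Sigma)

text \<open>Transposition swaps the coordinates of a cell and thereby negates its content.\<close>

lemma content_poly_transpose:
  assumes "is_partition p"
  shows "content_poly (transpose_partition p) = (\<Sum>(i, j)\<in>young_diagram p. qpow (int i - int j))"
  unfolding content_poly_def young_diagram_transpose[OF assms]
  by (rule sum.reindex_bij_witness[where i = prod.swap and j = prod.swap]) auto

lemma qpow_row_telescope:
  "(qpow 1 - 1) * (\<Sum>j<n. qpow (int j - a)) = qpow (int n - a) - qpow (- a)"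
proof (induction n)
  case (Suc n)
  then show ?case
    by (simp add: distrib_left left_diff_distrib qpow_mult) (simp add: algebra_simps)
qed simp

lemma sum_qpow_rows:
  assumes "\<And>i. i \<ge> M \<Longrightarrow> p i = 0"
  shows "(\<Sum>i<M. qpow (int (p i) - int i)) = (\<Sum>i<M. qpow (- int i)) + (qpow 1 - 1) * content_poly p"
proof -
  have "(qpow 1 - 1) * content_poly p = (\<Sum>i<M. qpow (int (p i) - int i) - qpow (- int i))"
    by (simp add: content_poly_rows[OF assms] sum_distrib_left[of "qpow 1 - 1" _ "{..<M}"]
        qpow_row_telescope)
  then show ?thesis by (simp add: sum_subtractf)
qed

lemma sum_qpow_rows_transpose:
  assumes "is_partition p" "\<And>i. i \<ge> M \<Longrightarrow> p i = 0"
  shows "(\<Sum>j<M. qpow (int j - int (p j)))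
    = (\<Sum>j<M. qpow (int j)) + (qpow (-1) - 1) * content_poly (transpose_partition p)"
proof -
  have row: "(qpow (-1) - 1) * (\<Sum>j<n. qpow (a - int j)) = qpow (a - int n) - qpow a" for n a
  proof (induction n)
    case (Suc n)
    then show ?case
      by (simp add: distrib_left left_diff_distrib qpow_mult) (simp add: algebra_simps)
  qed simp
  have "content_poly (transpose_partition p) = (\<Sum>i<M. \<Sum>j<p i. qpow (int i - int j))"
    by (simp add: content_poly_transpose[OF assms(1)] young_diagram_Sigma[OF assms(2)] sum.Sigma)
  then have "(qpow (-1) - 1) * content_poly (transpose_partition p)
      = (\<Sum>i<M. qpow (int i - int (p i)) - qpow (int i))"
    by (simp add: sum_distrib_left[of "qpow (-1) - 1" _ "{..<M}"] row)
  then show ?thesis by (simp add: sum_subtractf)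
qed


section \<open>The Laurent polynomial in terms of contents\<close>

lemma partition_series_sums_content:
  assumes "is_partition p" "norm q > 1"
  shows "(\<lambda>i. q powi (int (p i) - int (Suc i)))
    sums ((q - 1) / q * laurent_eval (content_poly p) q + 1 / (q - 1))"
proof -
  have q0: "q \<noteq> 0" using assms(2) by auto
  obtain M where M: "\<And>i. i \<ge> M \<Longrightarrow> p i = 0"
    using is_partition_bound[OF assms(1)] by blast
  let ?d = "\<lambda>i. q powi (int (p i) - int (Suc i)) - q powi (- int (Suc i))"
  have shift: "q powi (a - int (Suc i)) = q powi (a - int i) / q" for a i
    using power_int_diff[of q "a - int i" 1] q0 by (simp add: algebra_simps)
  have "?d sums (\<Sum>i<M. ?d i)"
    by (rule sums_finite) (auto simp: M)
  moreover have "(\<Sum>i<M. ?d i) = (q - 1) / q * laurent_eval (content_poly p) q"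
  proof -
    have "(\<Sum>i<M. q powi (int (p i) - int i))
        = (\<Sum>i<M. q powi (- int i)) + (q - 1) * laurent_eval (content_poly p) q"
      using arg_cong[where f = "\<lambda>P. laurent_eval P q", OF sum_qpow_rows[OF M]] q0
      by (simp add: laurent_eval_add laurent_eval_sum laurent_eval_mult laurent_eval_diff
          laurent_eval_1)
    then show ?thesis
      using shift[of 0] shift
      by (simp add: sum_subtractf del: of_nat_Suc flip: sum_divide_distrib)
        (simp add: add_divide_distrib)
  qed
  ultimately have "?d sums ((q - 1) / q * laurent_eval (content_poly p) q)" by simp
  from sums_add[OF this inverse_powers_sums[OF assms(2)]] show ?thesis by simp
qed

text \<open>
  Each series is a correction of the geometric series \<open>1 / (q - 1)\<close>. In the product the square
  of that geometric series is the term subtracted in \<open>f\<close>, and in the mixed terms its denominator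
  cancels, so a Laurent polynomial remains.
\<close>

lemma f_laurent_content:
  assumes "is_partition l" "is_partition m"
  shows "f_laurent l m = (qpow 1 - 2 + qpow (-1)) * content_poly l * content_poly m
    + content_poly l + content_poly m" (is "_ = ?P")
proof -
  have "laurent_eval (f_laurent l m - ?P) q = 0" if q: "norm q > 1" for q
  proof -
    have q0: "q \<noteq> 0" and q1: "q - 1 \<noteq> 0" using q by auto
    define a b where "a = laurent_eval (content_poly l) q" and "b = laurent_eval (content_poly m) q"
    have two: "laurent_eval 2 q = 2"
      using laurent_eval_add[of 1 1 q] by (simp add: laurent_eval_1)
    have "laurent_eval (f_laurent l m) q
      = q * (((q - 1) / q * a + 1 / (q - 1)) * ((q - 1) / q * b + 1 / (q - 1))
          - 1 / (q - 1) * (1 / (q - 1)))"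
      unfolding f_laurent_eval[OF assms q, symmetric] f_fun_def a_def b_def
        sums_unique[OF partition_series_sums_content[OF assms(1) q], symmetric]
        sums_unique[OF partition_series_sums_content[OF assms(2) q], symmetric]
        sums_unique[OF inverse_powers_sums[OF q], symmetric] ..
    also have "\<dots> = (q - 2 + 1 / q) * a * b + a + b"
      using q0 q1 by (simp add: divide_simps) algebra
    also have "\<dots> = laurent_eval ?P q"
      using q0 by (simp add: laurent_eval_add laurent_eval_diff laurent_eval_mult two a_def b_def
          power_int_minus inverse_eq_divide)
    finally show ?thesis by (simp add: laurent_eval_diff)
  qed
  then have "f_laurent l m - ?P = 0" by (rule laurent_eval_eq_0_imp)
  then show ?thesis by simp
qed


section \<open>Truncating the double sum\<close>

abbreviation double_summand :: "(nat \<Rightarrow> nat) \<Rightarrow> (nat \<Rightarrow> nat) \<Rightarrow> nat \<Rightarrow> nat \<Rightarrow> laurent_poly" where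
  "double_summand \<mu> \<nu> i j \<equiv> qpow (int (\<mu> i) - int (\<nu> j) + int j - int i) - qpow (int j - int i)"

text \<open>
  Both families of powers factor into a part depending on \<open>i\<close> and a part depending on \<open>j\<close>. The
  two finite geometric series, multiplied by the factors \<open>q - 1\<close> and \<open>q powi (-1) - 1\<close> of the
  content polynomials, collapse to their end points \<open>q\<^sup>M - 1\<close> and \<open>q powi (-M) - 1\<close>.
\<close>

lemma truncated_double_sum:
  assumes "is_partition \<mu>" "is_partition \<nu>"
    and "\<And>i. i \<ge> M \<Longrightarrow> \<mu> i = 0" "\<And>j. j \<ge> M \<Longrightarrow> \<nu> j = 0"
  shows "f_laurent \<mu> (transpose_partition \<nu>) = - (\<Sum>i<M. \<Sum>j<M. double_summand \<mu> \<nu> i j)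
    + qpow (int M) * content_poly \<mu>
    + qpow (- int M) * content_poly (transpose_partition \<nu>)"
proof -
  define U V where "U = (\<Sum>i<M. qpow (- int i))" and "V = (\<Sum>j<M. qpow (int j))"
  define K L where "K = content_poly \<mu>" and "L = content_poly (transpose_partition \<nu>)"
  define x y where "x = qpow 1" and "y = qpow (-1)"
  have xy: "x * y = 1" by (simp add: x_def y_def qpow_mult qpow_0)
  have V: "(x - 1) * V = qpow (int M) - 1"
    unfolding V_def x_def using qpow_row_telescope[where n = M and a = 0] by (simp add: qpow_0)
  have U: "(y - 1) * U = qpow (- int M) - 1"
    unfolding U_def y_def
    by (induction M) (simp_all add: distrib_left left_diff_distrib qpow_mult qpow_0)
  have summand: "double_summand \<mu> \<nu> i j
    = qpow (int (\<mu> i) - int i) * qpow (int j - int (\<nu> j)) - qpow (- int i) * qpow (int j)" for i j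
    by (simp add: qpow_mult algebra_simps)
  have "(\<Sum>i<M. \<Sum>j<M. double_summand \<mu> \<nu> i j)
    = (\<Sum>i<M. qpow (int (\<mu> i) - int i)) * (\<Sum>j<M. qpow (int j - int (\<nu> j))) - U * V"
    by (simp add: summand U_def V_def sum_product sum_subtractf)
  also have "\<dots> = (U + (x - 1) * K) * (V + (y - 1) * L) - U * V"
    using sum_qpow_rows[OF assms(3)] sum_qpow_rows_transpose[OF assms(2,4)]
    by (simp add: U_def V_def x_def y_def K_def L_def)
  also have "\<dots> = (x * y - x - y + 1) * K * L + ((x - 1) * V) * K + ((y - 1) * U) * L"
    by (simp add: algebra_simps)
  also have "\<dots> = (2 - x - y) * K * L + (qpow (int M) - 1) * K + (qpow (- int M) - 1) * L"
    unfolding U V xy by simp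
  finally show ?thesis
    by (simp add: f_laurent_content[OF assms(1) is_partition_transpose[OF assms(2)]]
        K_def L_def x_def y_def algebra_simps)
qed

lemma lookup_qpow_mult_content_poly:
  assumes "\<And>i j. (i, j) \<in> young_diagram p \<Longrightarrow> a + (int j - int i) \<noteq> k"
  shows "Poly_Mapping.lookup (qpow a * content_poly p) k = 0"
proof -
  have "qpow a * content_poly p = (\<Sum>x\<in>young_diagram p. qpow (a + (int (snd x) - int (fst x))))"
    by (simp add: content_poly_def sum_distrib_left qpow_mult split_def)
  also have "Poly_Mapping.lookup \<dots> k = 0"
    unfolding lookup_sum lookup_qpow by (rule sum.neutral) (use assms in auto)
  finally show ?thesis .
qed

text \<open>
  The contents of a fixed diagram are bounded, so the shift by \<open>M\<close> or \<open>-M\<close> eventually moves all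
  of them past \<open>k\<close>: the error terms of the truncation do not contribute to a fixed coefficient.
\<close>

lemma eventually_lookup_qpow_mult_content_poly:
  assumes "is_partition p"
  shows "\<forall>\<^sub>F M in sequentially. Poly_Mapping.lookup (qpow (int M) * content_poly p) k = 0"
    and "\<forall>\<^sub>F M in sequentially. Poly_Mapping.lookup (qpow (- int M) * content_poly p) k = 0"
proof -
  obtain N where N: "\<And>i. i \<ge> N \<Longrightarrow> p i = 0"
    using is_partition_bound[OF assms] by blast
  have cell: "i < N \<and> j < p 0" if "(i, j) \<in> young_diagram p" for i j
    using that N[of i] antimonoD[of p 0 i] assms
    by (force simp: young_diagram_def is_partition_def not_less)
  have large: "\<forall>\<^sub>F M in sequentially. M \<ge> N + p 0 + nat \<bar>k\<bar>"
    by (rule eventually_ge_at_top)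
  show "\<forall>\<^sub>F M in sequentially. Poly_Mapping.lookup (qpow (int M) * content_poly p) k = 0"
    using large
    by (rule eventually_mono) (intro lookup_qpow_mult_content_poly, drule cell, linarith)
  show "\<forall>\<^sub>F M in sequentially. Poly_Mapping.lookup (qpow (- int M) * content_poly p) k = 0"
    using large
    by (rule eventually_mono) (intro lookup_qpow_mult_content_poly, drule cell, linarith)
qed

lemma eventually_partition_zero:
  assumes "is_partition p"
  shows "\<forall>\<^sub>F M in sequentially. \<forall>i\<ge>M. p i = 0"
proof -
  obtain N where N: "\<And>i. i \<ge> N \<Longrightarrow> p i = 0"
    using is_partition_bound[OF assms] by blast
  show ?thesis
    using eventually_ge_at_top[of N] by eventually_elim (simp add: N)
qed

lemma eventually_C_coeff:
  assumes "is_partition \<mu>" "is_partition \<nu>"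
  shows "\<forall>\<^sub>F M in sequentially. C_coeff k \<mu> (transpose_partition \<nu>)
    = - Poly_Mapping.lookup (\<Sum>i<M. \<Sum>j<M. double_summand \<mu> \<nu> i j) k"
  using eventually_partition_zero[OF assms(1)] eventually_partition_zero[OF assms(2)]
    eventually_lookup_qpow_mult_content_poly(1)[OF assms(1), of k]
    eventually_lookup_qpow_mult_content_poly(2)[OF is_partition_transpose[OF assms(2)], of k]
proof eventually_elim
  case (elim M)
  then show ?case
    unfolding C_coeff_def
    by (subst truncated_double_sum[OF assms, of M]) (simp_all only: lookup_add lookup_uminus simp_thms add_0_right)
qed

lemma eventually_formal_sum_coeff:
  assumes "is_partition \<mu>" "is_partition \<nu>"
  shows "\<forall>\<^sub>F M in sequentially. formal_sum_coeff (double_summand \<mu> \<nu>) k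
    = Poly_Mapping.lookup (\<Sum>i<M. \<Sum>j<M. double_summand \<mu> \<nu> i j) k"
proof -
  let ?g = "\<lambda>(i, j). Poly_Mapping.lookup (double_summand \<mu> \<nu> i j) k"
  let ?S = "{x. ?g x \<noteq> 0}"
  have S: "?S = {(i, j). Poly_Mapping.lookup (double_summand \<mu> \<nu> i j) k \<noteq> 0}" by auto
  have fin: "finite ?S"
    unfolding S by (rule finite_contributions[OF assms])
  have "finite (fst ` ?S \<union> snd ` ?S)" using fin by blast
  then obtain N where N: "\<And>n. n \<in> fst ` ?S \<union> snd ` ?S \<Longrightarrow> n < N"
    using finite_nat_set_iff_bounded by meson
  have sub: "?S \<subseteq> {..<N} \<times> {..<N}"
  proof
    fix x assume "x \<in> ?S"
    then have "fst x < N" "snd x < N" by (intro N UnI1 UnI2 imageI, assumption)+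
    then show "x \<in> {..<N} \<times> {..<N}" by (simp add: mem_Times_iff)
  qed
  show ?thesis
    using eventually_ge_at_top[of N]
  proof eventually_elim
    case (elim M)
    then have "?S \<subseteq> {..<M} \<times> {..<M}" 
      by (intro order_trans[OF sub]) auto
    then have "formal_sum_coeff (double_summand \<mu> \<nu>) k = sum ?g ({..<M} \<times> {..<M})"
      unfolding formal_sum_coeff_def by (intro Sum_any.expand_superset) auto
    then show ?case by (simp add: lookup_sum sum.cartesian_product split_def)
  qed
qed


section \<open>Nonnegativity\<close>

lemma shifted_parts_inj:
  assumes "is_partition p" "int (p i) - int i = int (p i') - int i'"
  shows "i = i'"
proof -
  have "p b \<le> p a" if "a \<le> b" for a b
    using assms(1) that by (simp add: is_partition_def antimonoD)
  from this[of i i'] this[of i' i] assms(2) show ?thesis by linarith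
qed

lemma card_diagonal:
  "int M - \<bar>k\<bar> \<le> int (card {(i, j) \<in> {..<M} \<times> {..<M}. int j - int i = k})"
proof -
  let ?h = "\<lambda>n. (n + nat (- k), n + nat k)"
  have "card (?h ` {..<M - nat \<bar>k\<bar>}) \<le> card {(i, j) \<in> {..<M} \<times> {..<M}. int j - int i = k}"
    by (rule card_mono) (auto intro: finite_subset[of _ "{..<M} \<times> {..<M}"])
  moreover have "card (?h ` {..<M - nat \<bar>k\<bar>}) = M - nat \<bar>k\<bar>"
    by (subst card_image) (auto simp: inj_on_def)
  ultimately show ?thesis by linarith
qed

text \<open>
  For \<open>k \<ge> 0\<close> every admissible \<open>i\<close> is below \<open>M - k\<close>, since a later index would have a zero part
  and hence \<open>\<mu>\<^sub>i - i = -i \<le> k - M < \<nu>\<^sub>j - j + k\<close>. For \<open>k \<le> 0\<close> the same holds for \<open>j\<close>. Projecting to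
  the bounded index is injective.
\<close>

lemma card_shifted_coincidences:
  assumes "is_partition \<mu>" "is_partition \<nu>"
    and zero: "\<And>i. i + nat \<bar>k\<bar> \<ge> M \<Longrightarrow> \<mu> i = 0" "\<And>j. j + nat \<bar>k\<bar> \<ge> M \<Longrightarrow> \<nu> j = 0"
    and "nat \<bar>k\<bar> \<le> M"
  shows "int (card {(i, j) \<in> {..<M} \<times> {..<M}. int (\<mu> i) - int (\<nu> j) + int j - int i = k})
    \<le> int M - \<bar>k\<bar>" (is "int (card ?S) \<le> _")
proof -
  have "card ?S \<le> card {..<M - nat \<bar>k\<bar>}"
  proof (cases "k \<ge> 0")
    case True
    show ?thesis
    proof (rule card_inj_on_le[of fst])
      show "inj_on fst ?S"
        by (auto simp: inj_on_def intro: shifted_parts_inj[OF assms(2)])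
      show "fst ` ?S \<subseteq> {..<M - nat \<bar>k\<bar>}"
      proof clarsimp
        fix i j assume "i < M" "j < M" "k = int (\<mu> i) - int (\<nu> j) + int j - int i"
        then show "i < M - nat \<bar>int (\<mu> i) - int (\<nu> j) + int j - int i\<bar>"
          using zero(1)[of i] True by linarith
      qed
    qed simp
  next
    case False
    show ?thesis
    proof (rule card_inj_on_le[of snd])
      show "inj_on snd ?S"
        by (auto simp: inj_on_def intro: shifted_parts_inj[OF assms(1)])
      show "snd ` ?S \<subseteq> {..<M - nat \<bar>k\<bar>}"
      proof clarsimp
        fix i j assume "i < M" "j < M" "k = int (\<mu> i) - int (\<nu> j) + int j - int i"
        then show "j < M - nat \<bar>int (\<mu> i) - int (\<nu> j) + int j - int i\<bar>"
          using zero(2)[of j] False by linarith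
      qed
    qed simp
  qed
  then show ?thesis using assms(5) by simp
qed

lemma lookup_double_sum_qpow:
  fixes e :: "nat \<Rightarrow> nat \<Rightarrow> int"
  shows
  "Poly_Mapping.lookup (\<Sum>i<M. \<Sum>j<M. qpow (e i j)) k
    = int (card {(i, j) \<in> {..<M} \<times> {..<M}. e i j = k})"
proof -
  have "Poly_Mapping.lookup (\<Sum>i<M. \<Sum>j<M. qpow (e i j)) k
      = (\<Sum>x\<in>{..<M} \<times> {..<M}. if e (fst x) (snd x) = k then 1 else 0)"
    by (simp add: lookup_sum lookup_qpow sum.cartesian_product split_def)
  also have "\<dots> = int (card {x \<in> {..<M} \<times> {..<M}. e (fst x) (snd x) = k})"
    by (simp flip: sum.inter_filter)
  finally show ?thesis by (simp add: split_def mem_Times_iff conj_assoc)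
qed

lemma eventually_truncated_coeff_nonpos:
  assumes "is_partition \<mu>" "is_partition \<nu>"
  shows "\<forall>\<^sub>F M in sequentially.
    Poly_Mapping.lookup (\<Sum>i<M. \<Sum>j<M. double_summand \<mu> \<nu> i j) k \<le> 0"
proof -
  obtain A where A: "\<And>i. i \<ge> A \<Longrightarrow> \<mu> i = 0"
    using is_partition_bound[OF assms(1)] by blast
  obtain B where B: "\<And>i. i \<ge> B \<Longrightarrow> \<nu> i = 0"
    using is_partition_bound[OF assms(2)] by blast
  show ?thesis
    using eventually_ge_at_top[of "A + B + nat \<bar>k\<bar>"]
  proof eventually_elim
    case (elim M)
    have "int (card {(i, j) \<in> {..<M} \<times> {..<M}. int (\<mu> i) - int (\<nu> j) + int j - int i = k})
        \<le> int M - \<bar>k\<bar>"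
      using elim by (intro card_shifted_coincidences[OF assms] A B) linarith+
    also note card_diagonal
    finally show ?case
      by (simp only: sum_subtractf lookup_minus lookup_double_sum_qpow)
  qed
qed

theorem theorem5p1:
  fixes \<mu>1 \<mu>2 :: "nat \<Rightarrow> nat"
  assumes "is_partition \<mu>1" and "is_partition \<mu>2"
  shows "(\<forall>k. C_coeff k \<mu>1 (transpose_partition \<mu>2) = 0 \<or> C_coeff k \<mu>1 (transpose_partition \<mu>2) > 0)
    \<and> (\<forall>k. C_coeff k \<mu>1 (transpose_partition \<mu>2) =
          - formal_sum_coeff
              (\<lambda>i j. qpow (int (\<mu>1 i) - int (\<mu>2 j) + int j - int i) - qpow (int j - int i)) k)"
proof -
  have main: "C_coeff k \<mu>1 (transpose_partition \<mu>2) \<ge> 0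
      \<and> C_coeff k \<mu>1 (transpose_partition \<mu>2) = - formal_sum_coeff (double_summand \<mu>1 \<mu>2) k" for k
  proof -
    have "\<forall>\<^sub>F M in sequentially. C_coeff k \<mu>1 (transpose_partition \<mu>2) \<ge> 0
      \<and> C_coeff k \<mu>1 (transpose_partition \<mu>2) = - formal_sum_coeff (double_summand \<mu>1 \<mu>2) k"
      using eventually_C_coeff[OF assms, of k] eventually_formal_sum_coeff[OF assms, of k]
        eventually_truncated_coeff_nonpos[OF assms, of k]
      by eventually_elim linarith
    then show ?thesis by simp
  qed
  show ?thesis
    using main by (intro conjI allI) (metis order_le_less, blast)
qed

end
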